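(* Let $\mathbb{R}^n$ and $\mathbb{R}^m$ be endowed with their Euclidean norms $\|\cdot\|$. Let $a_1,\dots,a_m\in\mathbb{R}^n$ and let $\overline b\in\mathbb{R}^m$ be such that the linear system $\{\langle a_i,x\rangle\le\overline b_i,\ i=1,\dots,m\}$ is inconsistent and for each $i=1,\dots,m$ there exists $\widehat x_i\in\mathbb{R}^n$ with $\langle a_i,\widehat x_i\rangle<\overline b_i$. Let $A$ be the $m\times n$ matrix whose rows are $a_i'$, $i=1,\dots,m$. Let $S_i:=\{x\in\mathbb{R}^n:\langle a_i,x\rangle\le\overline b_i\}$, $$\mathcal{A}:=\arg\min_{x\in\mathbb{R}^n}\sum_{i=1}^m\|a_i\|^2 d_{S_i}^2(x),$$ and let $\overline d\in\mathbb{R}^m$ be the vector whose $i$-th coordinate is the constant value of $\|a_i\|\,d_{S_i}(\cdot)$ on $\mathcal{A}$. For $(x^0,h^0)\in\mathbb{R}^n\times\mathbb{R}^m$ the following conditions are equivalent: (i) $(x^0,h^0)\in\mathcal{A}\times\{\overline d\}$; (ii) $(x^0,h^0)$ is a solution of the system, in the variable $(x,h)\in\mathbb{R}^n\times\mathbb{R}^m$, $$[Ax-\overline b]_+=h,\qquad A'h=0_n;$$ (iii) $(x^0,h^0)$ is an optimal solution of the quadratic problem, in the variable $(x,h)\in\mathbb{R}^n\times\mathbb{R}^m$, $$\min\ \langle h,h\rangle\quad\text{s.t. } Ax\le\overline b+h,\ \ h\ge 0_m .$$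
   Context: Prime denotes transposition. $d_{S_i}$ is the Euclidean distance function to $S_i$. For $y\in\mathbb{R}^m$, $[y]_+=(\max\{y_i,0\})_{i=1,\dots,m}$; vector inequalities are coordinatewise; $0_n$, $0_m$ are zero vectors. The set $\mathcal{A}$ is nonempty and each function $\|a_i\|d_{S_i}$ is constant on $\mathcal{A}$, so $\overline d$ is well defined. *)

theory Defs
  imports "HOL-Analysis.Analysis"
begin

definition row_matrix :: "('m::finite \<Rightarrow> real^'n::finite) \<Rightarrow> real^'n^'m" where
  "row_matrix a = (\<chi> i. a i)"

definition vec_pos_part :: "real^'m::finite \<Rightarrow> real^'m" where
  "vec_pos_part y = (\<chi> i. max (y $ i) 0)"

definition halfsp :: "('m::finite \<Rightarrow> real^'n::finite) \<Rightarrow> real^'m \<Rightarrow> 'm \<Rightarrow> (real^'n) set" where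
  "halfsp a b i = {x. a i \<bullet> x \<le> b $ i}"

text \<open>The library function \<open>infdist x S\<close> is the Euclidean distance from \<open>x\<close> to \<open>S\<close> when \<open>S\<close> is
  nonempty; its conventional value 0 for empty \<open>S\<close> plays no role where each half-space is nonempty.\<close>

definition best_approx :: "('m::finite \<Rightarrow> real^'n::finite) \<Rightarrow> real^'m \<Rightarrow> (real^'n) set" where
  "best_approx a b =
     {x. is_arg_min (\<lambda>x. \<Sum>i\<in>UNIV. (norm (a i))\<^sup>2 * (infdist x (halfsp a b i))\<^sup>2) (\<lambda>x. True) x}"

text \<open>The description is meaningful only if the minimizer set is nonempty and each weighted distance
  is constant on it; both are consequences of the hypotheses under which it is used.\<close>

definition d_bar :: "('m::finite \<Rightarrow> real^'n::finite) \<Rightarrow> real^'m \<Rightarrow> real^'m" where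
  "d_bar a b =
     (\<chi> i. THE c. \<forall>x \<in> best_approx a b. norm (a i) * infdist x (halfsp a b i) = c)"

end

theory Submission
  imports Defs
begin

text \<open>
  Write \<open>r x = [A x - b]\<^sub>+\<close> for the residual at \<open>x\<close>.  The distance from \<open>x\<close> to a nonempty half-space
  \<open>{z. a \<bullet> z \<le> \<beta>}\<close>, multiplied by \<open>\<parallel>a\<parallel>\<close>, is \<open>max (a \<bullet> x - \<beta>) 0\<close> (\<open>norm_mult_infdist_halfspace\<close>).  So
  the objective defining the best approximate solutions is \<open>\<parallel>r x\<parallel>\<^sup>2\<close>, and each of the three conditions
  says that \<open>\<parallel>r x\<parallel>\<^sup>2\<close> is minimal at \<open>x0\<close> and that \<open>h0 = r x0\<close>.

  The equation \<open>A' (r x) = 0\<close> is the first-order condition for this convex objective, with half the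
  gradient on its left-hand side.  That it is necessary is seen by a descent step
  along \<open>-A' (r x)\<close>.  That it is sufficient, for the least-squares problem as well as for the quadratic
  programme, comes from one inequality (\<open>residual_inner_le\<close>): if \<open>A' (r x) = 0\<close> then \<open>r x\<close> is a
  Farkas-type multiplier, which gives \<open>\<parallel>r x\<parallel>\<^sup>2 \<le> r x \<bullet> h\<close> for every feasible \<open>(y, h)\<close>.  Therefore
  \<open>\<parallel>h - r x\<parallel>\<^sup>2 \<le> \<parallel>h\<parallel>\<^sup>2 - \<parallel>r x\<parallel>\<^sup>2\<close>, so that \<open>r x\<close> is the unique feasible slack of least norm.  The uniqueness
  is also what makes the residual constant on the set of minimizers, and hence the vector of constant
  weighted distances well defined.
\<close>

section \<open>Distance to a half-space\<close>

text \<open>The nearest point is found by moving along the normal \<open>a\<close>, and Cauchy-Schwarz shows that no point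
  of the half-space is nearer.  Multiplying by \<open>norm a\<close> keeps the formula valid for \<open>a = 0\<close>, when a
  nonempty half-space is the whole space.\<close>

lemma norm_mult_infdist_halfspace:
  fixes a x :: "'a::real_inner"
  assumes "\<exists>z. a \<bullet> z \<le> \<beta>"
  shows "norm a * infdist x {z. a \<bullet> z \<le> \<beta>} = max (a \<bullet> x - \<beta>) 0"
proof (cases "a \<bullet> x \<le> \<beta>")
  case True
  then show ?thesis by simp
next
  case False
  with assms have "a \<noteq> 0" by auto
  then have na: "norm a > 0" by simp
  let ?S = "{z. a \<bullet> z \<le> \<beta>}"
  define p where "p = x - ((a \<bullet> x - \<beta>) / (norm a)\<^sup>2) *\<^sub>R a"
  have "a \<bullet> p = \<beta>"
    using na by (simp add: p_def inner_diff_right dot_square_norm)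
  then have "p \<in> ?S" by simp
  have "dist x p = (a \<bullet> x - \<beta>) / norm a"
    using False na by (simp add: p_def dist_norm power2_eq_square)
  with infdist_le[OF \<open>p \<in> ?S\<close>, of x] have "infdist x ?S \<le> (a \<bullet> x - \<beta>) / norm a"
    by simp
  moreover have "(a \<bullet> x - \<beta>) / norm a \<le> infdist x ?S"
  proof -
    have "(a \<bullet> x - \<beta>) / norm a \<le> dist x z" if "z \<in> ?S" for z
    proof -
      have "a \<bullet> x - \<beta> \<le> a \<bullet> (x - z)"
        using that by (simp add: inner_diff_right)
      also have "\<dots> \<le> norm a * dist x z"
        unfolding dist_norm by (rule norm_cauchy_schwarz)
      finally show ?thesis
        using na by (simp add: divide_le_eq mult.commute)
    qed
    then show ?thesis
      using \<open>p \<in> ?S\<close> by (auto simp: infdist_def intro!: cINF_greatest)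
  qed
  ultimately show ?thesis
    using False na by (simp add: field_simps max_def)
qed

section \<open>Residuals and the first-order condition\<close>

abbreviation residual :: "real^'n^'m \<Rightarrow> real^'m \<Rightarrow> real^'n \<Rightarrow> real^'m" where
  "residual A b x \<equiv> vec_pos_part (A *v x - b)"

lemma vec_pos_part_nth [simp]: "vec_pos_part y $ i = max (y $ i) 0"
  by (simp add: vec_pos_part_def)

lemma inner_vec_pos_part_self: "vec_pos_part y \<bullet> y = vec_pos_part y \<bullet> vec_pos_part y"
  unfolding inner_vec_def by (intro sum.cong) (auto simp: max_def)

lemma residual_feasible:
  "A *v x \<le> b + residual A b x \<and> 0 \<le> residual A b x"
  by (auto simp: less_eq_vec_def max_def)

lemma residual_least_slack:
  assumes "A *v x \<le> b + h" and "0 \<le> h"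
  shows "residual A b x \<le> h"
  using assms by (auto simp: less_eq_vec_def algebra_simps)

lemma inner_mono_vec:
  fixes u v w :: "real^'m::finite"
  assumes "0 \<le> w" and "u \<le> v"
  shows "w \<bullet> u \<le> w \<bullet> v"
  using assms unfolding inner_vec_def less_eq_vec_def
  by (auto intro!: sum_mono mult_left_mono)

text \<open>The elementary reason that the first-order expansion of \<open>\<parallel>[y]\<^sub>+\<parallel>\<^sup>2\<close> has a remainder of at most
  \<open>\<parallel>u\<parallel>\<^sup>2\<close>: coordinatewise, \<open>max (s + u) 0\<close> lies between \<open>0\<close> and \<open>\<bar>max s 0 + u\<bar>\<close>.\<close>

lemma norm_vec_pos_part_add_le:
  "norm (vec_pos_part (y + u)) \<le> norm (vec_pos_part y + u)"
  by (rule norm_le_componentwise_cart) (auto simp: max_def)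

text \<open>The vector \<open>w = residual A b x\<close> satisfies \<open>w \<ge> 0\<close> and \<open>A' w = 0\<close>, so pairing any relaxed system
  \<open>A y \<le> b + h\<close> with \<open>w\<close> eliminates \<open>y\<close> and leaves \<open>- (w \<bullet> b) \<le> w \<bullet> h\<close>; the left-hand side does not
  depend on \<open>y\<close> and for \<open>y = x\<close> it evaluates to \<open>w \<bullet> w\<close>.\<close>

lemma residual_inner_le:
  assumes stat: "transpose A *v residual A b x = 0" and feas: "A *v y \<le> b + h"
  shows "residual A b x \<bullet> residual A b x \<le> residual A b x \<bullet> h"
proof -
  let ?w = "residual A b x"
  have elim: "?w \<bullet> (A *v z) = 0" for z
    using stat by (simp add: dot_lmul_matrix[symmetric])
  have "?w \<bullet> ?w = ?w \<bullet> (A *v x - b)"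
    by (rule inner_vec_pos_part_self[symmetric])
  also have "\<dots> = ?w \<bullet> (A *v y - b)"
    by (simp only: inner_diff_right elim)
  also have "\<dots> \<le> ?w \<bullet> h"
    using feas residual_feasible[of A x b]
    by (intro inner_mono_vec) (auto simp: less_eq_vec_def algebra_simps)
  finally show ?thesis .
qed

text \<open>The defect in minimality controls the distance between slacks, which yields optimality and
  uniqueness of the optimal slack at once.\<close>

lemma slack_gap:
  fixes w h :: "'a::real_inner"
  assumes "w \<bullet> w \<le> w \<bullet> h"
  shows "(norm (h - w))\<^sup>2 \<le> h \<bullet> h - w \<bullet> w"
  using assms by (simp add: power2_norm_eq_inner inner_diff inner_commute)

lemma slack_optimal:
  fixes w h :: "'a::real_inner"
  assumes "w \<bullet> w \<le> w \<bullet> h"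
  shows "w \<bullet> w \<le> h \<bullet> h"
  using slack_gap[OF assms] zero_le_power2[of "norm (h - w)"] by linarith

lemma slack_unique:
  fixes w h :: "'a::real_inner"
  assumes "w \<bullet> w \<le> w \<bullet> h" and "h \<bullet> h \<le> w \<bullet> w"
  shows "h = w"
proof -
  have "(norm (h - w))\<^sup>2 \<le> 0"
    using slack_gap[OF assms(1)] assms(2) by linarith
  then show ?thesis by simp
qed

text \<open>Necessity: with \<open>v = A' (r x)\<close>, moving from \<open>x\<close> to \<open>x - t v\<close> changes \<open>\<parallel>r x\<parallel>\<^sup>2\<close> by at most
  \<open>-2 t \<parallel>v\<parallel>\<^sup>2 + t\<^sup>2 \<parallel>A v\<parallel>\<^sup>2\<close>, which is negative for small \<open>t > 0\<close> unless \<open>v = 0\<close>.\<close>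

lemma residual_minimal_iff_stationary:
  "(\<forall>y. residual A b x \<bullet> residual A b x \<le> residual A b y \<bullet> residual A b y)
     \<longleftrightarrow> transpose A *v residual A b x = 0"
proof
  assume min: "\<forall>y. residual A b x \<bullet> residual A b x \<le> residual A b y \<bullet> residual A b y"
  let ?w = "residual A b x"
  define v where "v = transpose A *v ?w"
  define q where "q = (A *v v) \<bullet> (A *v v)"
  have q: "q \<ge> 0" by (simp add: q_def)
  have wAv: "?w \<bullet> (A *v v) = v \<bullet> v"
    by (simp add: v_def dot_lmul_matrix[symmetric])
  have descent: "2 * t * (v \<bullet> v) \<le> t\<^sup>2 * q" for t :: real
  proof -
    let ?y = "x - t *\<^sub>R v"
    have "A *v ?y - b = (A *v x - b) + (- t) *\<^sub>R (A *v v)"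
      by (simp add: matrix_vector_mult_diff_distrib matrix_vector_mult_scaleR algebra_simps)
    then have "norm (residual A b ?y) \<le> norm (?w + (- t) *\<^sub>R (A *v v))"
      by (metis norm_vec_pos_part_add_le)
    then have "residual A b ?y \<bullet> residual A b ?y
        \<le> (?w + (- t) *\<^sub>R (A *v v)) \<bullet> (?w + (- t) *\<^sub>R (A *v v))"
      by (simp add: norm_le)
    also have "\<dots> = ?w \<bullet> ?w - 2 * t * (?w \<bullet> (A *v v)) + t\<^sup>2 * q"
      by (simp add: q_def inner_add inner_diff inner_commute power2_eq_square algebra_simps)
    finally show ?thesis
      using min[rule_format, of ?y] wAv by simp
  qed
  \<comment> \<open>The optimal step is \<open>v \<bullet> v / q\<close>; the denominator \<open>q + 1\<close> avoids the case \<open>q = 0\<close>.\<close>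
  define t where "t = (v \<bullet> v) / (q + 1)"
  have "v \<bullet> v = 0"
  proof (rule ccontr)
    assume "v \<bullet> v \<noteq> 0"
    then have "t > 0"
      using q by (simp add: t_def)
    with descent[of t] have "2 * (v \<bullet> v) \<le> t * q"
      by (simp add: power2_eq_square mult.assoc)
    moreover have "v \<bullet> v = t * q + t"
      using q by (simp add: t_def field_simps add_nonneg_eq_0_iff)
    ultimately show False
      using \<open>t > 0\<close> inner_ge_zero[of v] by linarith
  qed
  then show "transpose A *v ?w = 0"
    by (simp add: v_def)
next
  assume stat: "transpose A *v residual A b x = 0"
  show "\<forall>y. residual A b x \<bullet> residual A b x \<le> residual A b y \<bullet> residual A b y"
    using residual_inner_le[OF stat] residual_feasible slack_optimal by blast
qed

section \<open>The three characterizations\<close>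

lemma norm_infdist_halfsp_eq_residual:
  assumes "\<exists>z. a i \<bullet> z \<le> b $ i"
  shows "norm (a i) * infdist x (halfsp a b i) = residual (row_matrix a) b x $ i"
  using norm_mult_infdist_halfspace[OF assms]
  by (simp add: halfsp_def row_matrix_def matrix_vector_mult_def inner_vec_def)

lemma best_approx_iff_stationary:
  assumes "\<And>i. \<exists>z. a i \<bullet> z \<le> b $ i"
  shows "x \<in> best_approx a b
     \<longleftrightarrow> transpose (row_matrix a) *v residual (row_matrix a) b x = 0"
proof -
  have "(\<Sum>i\<in>UNIV. (norm (a i))\<^sup>2 * (infdist y (halfsp a b i))\<^sup>2)
      = residual (row_matrix a) b y \<bullet> residual (row_matrix a) b y" for y
    unfolding inner_vec_def power_mult_distrib[symmetric]
      norm_infdist_halfsp_eq_residual[of a _ b, OF assms]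
    by (simp add: power2_eq_square)
  then show ?thesis
    by (simp only: best_approx_def is_arg_min_linorder mem_Collect_eq simp_thms
        residual_minimal_iff_stationary[symmetric])
qed

text \<open>By the uniqueness of the optimal slack, all minimizers have the same residual.\<close>

lemma d_bar_eq_residual:
  assumes nonempty: "\<And>i. \<exists>z. a i \<bullet> z \<le> b $ i" and x: "x \<in> best_approx a b"
  shows "d_bar a b = residual (row_matrix a) b x"
proof -
  let ?r = "residual (row_matrix a) b"
  have same: "?r y = ?r x" if "y \<in> best_approx a b" for y
  proof (rule slack_unique)
    have stat: "transpose (row_matrix a) *v ?r z = 0" if "z \<in> {x, y}" for z
      using that x \<open>y \<in> best_approx a b\<close> best_approx_iff_stationary[OF nonempty] by blast
    show "?r x \<bullet> ?r x \<le> ?r x \<bullet> ?r y"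
      using stat residual_feasible by (blast intro: residual_inner_le)
    show "?r y \<bullet> ?r y \<le> ?r x \<bullet> ?r x"
      using stat residual_minimal_iff_stationary by blast
  qed
  have "(THE c. \<forall>y\<in>best_approx a b. norm (a i) * infdist y (halfsp a b i) = c) = ?r x $ i" for i
    unfolding norm_infdist_halfsp_eq_residual[of a _ b, OF nonempty]
  proof (rule the_equality)
    show "\<forall>y\<in>best_approx a b. ?r y $ i = ?r x $ i"
      using same by (intro ballI) (rule arg_cong)
  qed (metis x)
  then show ?thesis
    unfolding d_bar_def vec_eq_iff by (simp only: vec_lambda_beta simp_thms)
qed

text \<open>An optimal slack at \<open>x\<close> is the residual at \<open>x\<close>, because that is the least feasible slack
  there; the programme then reduces to minimizing the norm of the residual.\<close>

lemma quadratic_programme_iff_stationary: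
  "is_arg_min (\<lambda>(x, h). h \<bullet> h) (\<lambda>(x, h). A *v x \<le> b + h \<and> 0 \<le> h) (x, h)
     \<longleftrightarrow> residual A b x = h \<and> transpose A *v h = 0"
proof
  assume opt: "is_arg_min (\<lambda>(x, h). h \<bullet> h) (\<lambda>(x, h). A *v x \<le> b + h \<and> 0 \<le> h) (x, h)"
  then have feas: "A *v x \<le> b + h" "0 \<le> h"
    by (auto simp: is_arg_min_linorder)
  have min: "h \<bullet> h \<le> k \<bullet> k" if "A *v y \<le> b + k" "0 \<le> k" for y k
    using opt that by (auto simp: is_arg_min_linorder)
  have "residual A b x \<bullet> residual A b x \<le> residual A b x \<bullet> h"
    using residual_feasible[of A x b] residual_least_slack[OF feas] by (intro inner_mono_vec) auto
  moreover have "h \<bullet> h \<le> residual A b x \<bullet> residual A b x"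
    using min residual_feasible by blast
  ultimately have h: "h = residual A b x"
    by (rule slack_unique)
  moreover have "h \<bullet> h \<le> residual A b y \<bullet> residual A b y" for y
    using min residual_feasible by blast
  ultimately show "residual A b x = h \<and> transpose A *v h = 0"
    using residual_minimal_iff_stationary[of A x b] by auto
next
  assume "residual A b x = h \<and> transpose A *v h = 0"
  then have h: "residual A b x = h" and stat: "transpose A *v residual A b x = 0"
    by auto
  have "h \<bullet> h \<le> k \<bullet> k" if "A *v y \<le> b + k" for y k
    using slack_optimal[OF residual_inner_le[OF stat that]] by (simp add: h)
  then show "is_arg_min (\<lambda>(x, h). h \<bullet> h) (\<lambda>(x, h). A *v x \<le> b + h \<and> 0 \<le> h) (x, h)"
    using residual_feasible[of A x b] by (auto simp: is_arg_min_linorder h)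
qed

theorem theorem29:
  fixes a :: "'m::finite \<Rightarrow> real^'n::finite"
    and b :: "real^'m"
    and x0 :: "real^'n"
    and h0 :: "real^'m"
  assumes inconsistent: "\<not> (\<exists>x. \<forall>i. a i \<bullet> x \<le> b $ i)"
    and slater: "\<forall>i. \<exists>x. a i \<bullet> x < b $ i"
  shows "((x0, h0) \<in> best_approx a b \<times> {d_bar a b}
            \<longleftrightarrow> vec_pos_part (row_matrix a *v x0 - b) = h0 \<and> transpose (row_matrix a) *v h0 = 0)
       \<and> (vec_pos_part (row_matrix a *v x0 - b) = h0 \<and> transpose (row_matrix a) *v h0 = 0
            \<longleftrightarrow> is_arg_min (\<lambda>(x, h). h \<bullet> h)
                  (\<lambda>(x :: real^'n, h). row_matrix a *v x \<le> b + h \<and> 0 \<le> h) (x0, h0))"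
proof -
  have nonempty: "\<And>i. \<exists>z. a i \<bullet> z \<le> b $ i"
    using slater by (meson less_imp_le)
  let ?r = "residual (row_matrix a) b"
  have "(x0, h0) \<in> best_approx a b \<times> {d_bar a b}
      \<longleftrightarrow> ?r x0 = h0 \<and> transpose (row_matrix a) *v h0 = 0"
    using best_approx_iff_stationary[OF nonempty, of x0] d_bar_eq_residual[OF nonempty, of x0]
    by auto
  then show ?thesis
    unfolding quadratic_programme_iff_stationary by blast
qed

end
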